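(* Let $X$ be a mixed cycle of order $n\geq 3$. Then $X$ is switching equivalent to exactly one of the following three mixed cycles: (1) $C_n$, the mixed cycle of order $n$ all of whose edges are undirected; (2) $C_n^{1}$, the mixed cycle of order $n$ with exactly one directed edge (all other edges undirected); (3) $C_n^{2}$, the mixed cycle of order $n$ having two consecutive directed edges $(u,v),(v,w)$ with the same direction, all its other edges being undirected.
   Context: A mixed graph $X$ has a finite vertex set $V(X)$, a set of undirected edges (unordered pairs $xy$) and a set of directed edges (ordered pairs $(x,y)$, directed from $x$ to $y$); its underlying graph $G(X)$ is the simple graph obtained by forgetting orientations. A mixed cycle is a mixed graph whose underlying graph is a cycle. For $V(X)=\{v_1,\dots,v_n\}$, the Hermitian adjacency matrix $H(X)$ has $(j,k)$ entry $1$ if $v_jv_k$ is an undirected edge, $i$ if $(v_j,v_k)$ is a directed edge, $-i$ if $(v_k,v_j)$ is a directed edge, and $0$ otherwise ($i^2=-1$). Two mixed graphs $X,Y$ on the same vertex set are switching equivalent if $H(X)=D^{-1}H(Y)D$ for some diagonal matrix $D$ whose diagonal entries lie in $\{\pm1,\pm i\}$ (mixed graphs being considered up to isomorphism). *)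

theory Defs
  imports Complex_Main "Jordan_Normal_Form.Matrix"
begin

record 'a mixed_graph =
  verts :: "'a set"
  uedges :: "'a set set"
  dedges :: "('a \<times> 'a) set"

text \<open>The underlying graph is simple, so there are no loops and any two vertices are joined by
  at most one edge: undirected, or directed in exactly one of the two directions.\<close>

definition mixed_graph :: "'a mixed_graph \<Rightarrow> bool" where
  "mixed_graph X \<longleftrightarrow>
     finite (verts X) \<and>
     (\<forall>e \<in> uedges X. \<exists>x \<in> verts X. \<exists>y \<in> verts X. x \<noteq> y \<and> e = {x, y}) \<and>
     (\<forall>(x, y) \<in> dedges X. x \<in> verts X \<and> y \<in> verts X \<and> x \<noteq> y \<and>
        (y, x) \<notin> dedges X \<and> {x, y} \<notin> uedges X)"

definition underlying_edges :: "'a mixed_graph \<Rightarrow> 'a set set" where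
  "underlying_edges X = uedges X \<union> {{x, y} | x y. (x, y) \<in> dedges X}"

definition is_cycle :: "'a set \<Rightarrow> 'a set set \<Rightarrow> bool" where
  "is_cycle V E \<longleftrightarrow>
     (\<exists>vs. distinct vs \<and> length vs \<ge> 3 \<and> V = set vs \<and>
        E = {{vs ! j, vs ! (Suc j mod length vs)} | j. j < length vs})"

definition mixed_cycle :: "'a mixed_graph \<Rightarrow> bool" where
  "mixed_cycle X \<longleftrightarrow> mixed_graph X \<and> is_cycle (verts X) (underlying_edges X)"

definition mixed_iso :: "'a mixed_graph \<Rightarrow> 'b mixed_graph \<Rightarrow> bool" where
  "mixed_iso X Y \<longleftrightarrow>
     mixed_graph X \<and> mixed_graph Y \<and>
     (\<exists>f. bij_betw f (verts X) (verts Y) \<and>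
        uedges Y = (\<lambda>e. f ` e) ` uedges X \<and>
        dedges Y = map_prod f f ` dedges X)"

text \<open>The list \<open>vs\<close> is an enumeration of the vertex set, fixing the order of rows and columns.\<close>

definition herm_adj :: "'a list \<Rightarrow> 'a mixed_graph \<Rightarrow> complex mat" where
  "herm_adj vs X = mat (length vs) (length vs) (\<lambda>(j, k).
     if {vs ! j, vs ! k} \<in> uedges X then 1
     else if (vs ! j, vs ! k) \<in> dedges X then \<i>
     else if (vs ! k, vs ! j) \<in> dedges X then - \<i>
     else 0)"

text \<open>In \<open>same_verts_switching\<close> the choice of the enumeration is immaterial, since reordering the
  vertices permutes the rows and columns of all the matrices simultaneously.
  The matrix \<open>D'\<close> is the inverse of \<open>D\<close>: \<open>similar_mat_wit A B D' D\<close> says that \<open>D\<close> and \<open>D'\<close> are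
  mutually inverse and \<open>A = D' * B * D\<close>.\<close>

definition same_verts_switching :: "'a mixed_graph \<Rightarrow> 'a mixed_graph \<Rightarrow> bool" where
  "same_verts_switching X Y \<longleftrightarrow>
     mixed_graph X \<and> mixed_graph Y \<and> verts X = verts Y \<and>
     (\<exists>vs. distinct vs \<and> set vs = verts X \<and>
        (\<exists>D D'. diagonal_mat D \<and>
           (\<forall>j < length vs. D $$ (j, j) \<in> {1, - 1, \<i>, - \<i>}) \<and>
           similar_mat_wit (herm_adj vs X) (herm_adj vs Y) D' D))"

text \<open>Mixed graphs are considered up to isomorphism, so switching equivalence to \<open>Z\<close> means switching
  equivalence, over the same vertex set, to some isomorphic copy of \<open>Z\<close>.\<close>

definition switching_equivalent :: "'a mixed_graph \<Rightarrow> 'b mixed_graph \<Rightarrow> bool" where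
  "switching_equivalent X Z \<longleftrightarrow> (\<exists>Y. mixed_iso Y Z \<and> same_verts_switching X Y)"

text \<open>The mixed cycle on \<open>0, \<dots>, n - 1\<close> (in this cyclic order) with set \<open>A\<close> of directed edges, where
  \<open>A\<close> is a set of pairs \<open>(j, j + 1 mod n)\<close>; all other edges are undirected.\<close>

definition cycle_with_dedges :: "nat \<Rightarrow> (nat \<times> nat) set \<Rightarrow> nat mixed_graph" where
  "cycle_with_dedges n A =
     \<lparr>verts = {..<n},
      uedges = {{j, Suc j mod n} | j. j < n \<and> (j, Suc j mod n) \<notin> A},
      dedges = A\<rparr>"

definition C0 :: "nat \<Rightarrow> nat mixed_graph" where
  "C0 n = cycle_with_dedges n {}"

definition C1 :: "nat \<Rightarrow> nat mixed_graph" where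
  "C1 n = cycle_with_dedges n {(0, 1)}"

definition C2 :: "nat \<Rightarrow> nat mixed_graph" where
  "C2 n = cycle_with_dedges n {(0, 1), (1, 2)}"

lemma C0_C1_C2_distinct: "distinct [C0 n, C1 n, C2 n]"
  by (simp add: C0_def C1_def C2_def cycle_with_dedges_def)

lemma mixed_cycle_cycle_with_dedges:
  assumes n: "n \<ge> 3" and A: "A \<subseteq> {(j, Suc j mod n) | j. j < n}"
  shows "mixed_cycle (cycle_with_dedges n A)"
proof -
  have ne: "Suc j mod n \<noteq> j" if "j < n" for j
    using that n by (auto simp: mod_Suc)
  have anti: "Suc (Suc j mod n) mod n \<noteq> j" if "j < n" for j
    using that n by (auto simp: mod_Suc split: if_splits)
  have unique: "j = k" if "j < n" "{j, Suc j mod n} = {k, Suc k mod n}" for j k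
    using that anti[of j] by (metis doubleton_eq_iff)
  have lt: "Suc j mod n < n" for j
    using n by simp
  have "(y, x) \<notin> A \<and> {x, y} \<notin> uedges (cycle_with_dedges n A) \<and> x < n \<and> y < n \<and> x \<noteq> y"
    if xy: "(x, y) \<in> A" for x y
  proof -
    have x: "x < n" "y = Suc x mod n" using A xy by auto
    have "(y, x) \<notin> A" using A anti[OF x(1)] x(2) by auto
    moreover have "{x, y} \<notin> uedges (cycle_with_dedges n A)"
      unfolding cycle_with_dedges_def x(2) using unique[OF x(1)] xy[unfolded x(2)] by simp metis
    ultimately show ?thesis using x ne[OF x(1)] lt[of x] by metis
  qed
  then have "mixed_graph (cycle_with_dedges n A)"
    unfolding mixed_graph_def
  proof (intro conjI ballI)
    fix e assume "e \<in> uedges (cycle_with_dedges n A)"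
    then obtain j where j: "j < n" "e = {j, Suc j mod n}"
      by (auto simp: cycle_with_dedges_def)
    then show "\<exists>x \<in> verts (cycle_with_dedges n A). \<exists>y \<in> verts (cycle_with_dedges n A).
        x \<noteq> y \<and> e = {x, y}"
      using ne[OF j(1)] lt[of j]
      by (intro bexI[of _ j] bexI[of _ "Suc j mod n"]) (auto simp: cycle_with_dedges_def)
  qed (auto simp: cycle_with_dedges_def)
  moreover have eq: "underlying_edges (cycle_with_dedges n A) = {{j, Suc j mod n} | j. j < n}"
    using A unfolding underlying_edges_def cycle_with_dedges_def by simp blast
  have "{{j, Suc j mod n} | j. j < n} =
      {{[0..<n] ! j, [0..<n] ! (Suc j mod length [0..<n])} | j. j < length [0..<n]}"
    using lt by (intro Collect_cong ex_cong1) auto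
  then have "is_cycle (verts (cycle_with_dedges n A)) (underlying_edges (cycle_with_dedges n A))"
    unfolding is_cycle_def eq using n
    by (intro exI[of _ "[0..<n]"]) (simp add: cycle_with_dedges_def atLeast0LessThan)
  ultimately show ?thesis by (simp add: mixed_cycle_def)
qed

lemma mixed_cycle_C0_C1_C2:
  assumes "n \<ge> 3"
  shows "mixed_cycle (C0 n)" "mixed_cycle (C1 n)" "mixed_cycle (C2 n)"
  unfolding C0_def C1_def C2_def
  by (rule mixed_cycle_cycle_with_dedges; use assms in \<open>force simp: mod_Suc numeral_2_eq_2\<close>)+

end

theory Submission
  imports Defs
begin

text \<open>The product of the entries of the Hermitian adjacency matrix around a closed walk does not
  change under switching, and for a mixed cycle it determines the switching class once the direction
  of traversal is fixed: switching along the cycle moves all of the weight to any prescribed edges.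
  Reversing the traversal conjugates the weight, so the classes correspond to
  \<open>1\<close>, \<open>{\<i>, - \<i>}\<close> and \<open>- 1\<close>, the weights of \<open>C\<^sub>n\<close>, \<open>C\<^sub>n\<^sup>1\<close> and \<open>C\<^sub>n\<^sup>2\<close>.\<close>

section \<open>Matrix entries and the weight of a closed walk\<close>

definition entry :: "'a mixed_graph \<Rightarrow> 'a \<Rightarrow> 'a \<Rightarrow> complex" where
  "entry X x y =
     (if {x, y} \<in> uedges X then 1
      else if (x, y) \<in> dedges X then \<i>
      else if (y, x) \<in> dedges X then - \<i>
      else 0)"

text \<open>The list need not follow edges: a consecutive non-adjacent pair makes the product 0.
  This lets the uniqueness argument evaluate the weight on lists about which only distinctness and
  length are known.\<close>

definition cycle_weight :: "'a mixed_graph \<Rightarrow> 'a list \<Rightarrow> complex" where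
  "cycle_weight X vs = (\<Prod>j<length vs. entry X (vs ! j) (vs ! (Suc j mod length vs)))"

text \<open>Exposes the witness list of \<open>is_cycle\<close>, thereby fixing a starting vertex
  and a direction of traversal; the weight depends on the direction.\<close>

definition cyclic_listing :: "'a mixed_graph \<Rightarrow> 'a list \<Rightarrow> bool" where
  "cyclic_listing X vs \<longleftrightarrow>
     mixed_graph X \<and> distinct vs \<and> length vs \<ge> 3 \<and> verts X = set vs \<and>
     underlying_edges X = {{vs ! j, vs ! (Suc j mod length vs)} | j. j < length vs}"

lemma herm_adj_entry:
  "herm_adj vs X = mat (length vs) (length vs) (\<lambda>(j, k). entry X (vs ! j) (vs ! k))"
  by (simp add: herm_adj_def entry_def)

lemma entry_cnj:
  assumes "mixed_graph X"
  shows "entry X y x = cnj (entry X x y)"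
  using assms unfolding mixed_graph_def entry_def by (auto simp: insert_commute)

lemma entry_eq_0_iff: "entry X x y = 0 \<longleftrightarrow> {x, y} \<notin> underlying_edges X"
  unfolding entry_def underlying_edges_def by (auto simp: doubleton_eq_iff)

lemma entry_cases: "entry X x y \<in> {0, 1, \<i>, - \<i>}"
  by (simp add: entry_def)

lemma bij_betw_Suc_mod:
  assumes "n > 0"
  shows "bij_betw (\<lambda>j. Suc j mod n) {..<n} {..<n}"
proof -
  have "inj_on (\<lambda>j. Suc j mod n) {..<n}"
    by (auto simp: inj_on_def mod_Suc split: if_splits)
  moreover have "(\<lambda>j. Suc j mod n) ` {..<n} \<subseteq> {..<n}"
    using assms by auto
  ultimately show ?thesis
    by (simp add: bij_betw_def endo_inj_surj)
qed

section \<open>Translation between matrix similarity and entrywise relations\<close>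

lemma mat_diag_entries:
  assumes "diagonal_mat D" "D \<in> carrier_mat n n"
  shows "D = mat_diag n (\<lambda>j. D $$ (j, j))"
  using assms by (intro eq_matI) (auto simp: diagonal_mat_def mat_diag_def)

text \<open>Left multiplication of \<open>A = D' * B * D\<close> by \<open>D\<close> gives
  \<open>D * A = B * D\<close>, in which no inverse occurs; comparing entries yields the relation.
  Of the diagonal values only non-vanishing is retained, which is enough to cancel their product
  later.\<close>

lemma same_verts_switching_entries:
  assumes "same_verts_switching X Y"
  obtains d where "\<And>x. x \<in> verts X \<Longrightarrow> d x \<noteq> 0"
    and "\<And>x y. x \<in> verts X \<Longrightarrow> y \<in> verts X \<Longrightarrow> d x * entry X x y = entry Y x y * d y"
proof -
  obtain vs D D' where vs: "distinct vs" "set vs = verts X" and D: "diagonal_mat D"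
    and unit: "\<forall>j < length vs. D $$ (j, j) \<in> {1, - 1, \<i>, - \<i>}"
    and sim: "similar_mat_wit (herm_adj vs X) (herm_adj vs Y) D' D"
    using assms unfolding same_verts_switching_def by blast
  let ?n = "length vs" and ?A = "herm_adj vs X" and ?B = "herm_adj vs Y"
  let ?e = "\<lambda>j. D $$ (j, j)"
  have A: "?A \<in> carrier_mat ?n ?n" and B: "?B \<in> carrier_mat ?n ?n"
    by (simp_all add: herm_adj_def)
  have wit: "D' \<in> carrier_mat ?n ?n" "D \<in> carrier_mat ?n ?n" "D * D' = 1\<^sub>m ?n"
    "?A = D' * ?B * D"
    using similar_mat_witD2[OF A sim] by auto
  have "D * ?A = D * (D' * (?B * D))"
    using wit B by (simp add: assoc_mult_mat[of _ ?n ?n _ ?n _ ?n])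
  also have "\<dots> = (D * D') * (?B * D)"
    by (rule assoc_mult_mat[symmetric]) (use wit B in auto)
  also have "\<dots> = ?B * D"
    using wit B by simp
  finally have "mat_diag ?n ?e * ?A = ?B * mat_diag ?n ?e"
    using mat_diag_entries[OF D wit(2)] by simp
  then have eq: "?e j * entry X (vs ! j) (vs ! k) = entry Y (vs ! j) (vs ! k) * ?e k"
    if "j < ?n" "k < ?n" for j k
    using that mat_diag_mult_left[OF A, of ?e] mat_diag_mult_right[OF B, of ?e]
    by (auto simp: herm_adj_entry dest!: arg_cong[where f = "\<lambda>M. M $$ (j, k)"])
  \<comment> \<open>\<open>i\<close> sends a vertex to its position in the enumeration, so that the
    diagonal of \<open>D\<close> becomes a function on vertices.\<close>
  define i where "i = inv_into {..<?n} ((!) vs)"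
  have bij: "bij_betw ((!) vs) {..<?n} (verts X)"
    using vs by (intro bij_betw_nth) auto
  have i: "i x < ?n" "vs ! i x = x" if "x \<in> verts X" for x
    using bij_betw_inv_into_right[OF bij that] bij_betw_apply[OF bij_betw_inv_into[OF bij] that]
    by (simp_all add: i_def)
  show ?thesis
  proof
    show "?e (i x) \<noteq> 0" if "x \<in> verts X" for x
      using unit i[OF that] by fastforce
    show "?e (i x) * entry X x y = entry Y x y * ?e (i y)" if "x \<in> verts X" "y \<in> verts X" for x y
      using eq[of "i x" "i y"] i that by simp
  qed
qed

text \<open>The converse passage, from entries to matrices: the diagonal entries are units, so
  \<open>D'\<close> can be taken as the diagonal matrix of their inverses.\<close>

lemma same_verts_switchingI:
  assumes X: "mixed_graph X" and Y: "mixed_graph Y" "verts X = verts Y"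
    and vs: "distinct vs" "set vs = verts X"
    and d: "\<And>j. j < length vs \<Longrightarrow> d j \<in> {1, - 1, \<i>, - \<i>}"
    and eq: "\<And>j k. j < length vs \<Longrightarrow> k < length vs \<Longrightarrow>
      d j * entry X (vs ! j) (vs ! k) = entry Y (vs ! j) (vs ! k) * d k"
  shows "same_verts_switching X Y"
proof -
  let ?n = "length vs" and ?A = "herm_adj vs X" and ?B = "herm_adj vs Y"
  let ?D = "mat_diag ?n d" and ?D' = "mat_diag ?n (\<lambda>j. inverse (d j))"
  have A: "?A \<in> carrier_mat ?n ?n" and B: "?B \<in> carrier_mat ?n ?n"
    by (simp_all add: herm_adj_def)
  have d0: "d j \<noteq> 0" if "j < ?n" for j
    using d[OF that] by auto
  have inv: "?D' * ?D = 1\<^sub>m ?n" "?D * ?D' = 1\<^sub>m ?n"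
    unfolding mat_diag_diag using d0 by (auto intro!: eq_matI simp: mat_diag_def)
  have "?D' * ?B * ?D = mat ?n ?n (\<lambda>(j, k). inverse (d j) * ?B $$ (j, k)) * ?D"
    by (simp add: mat_diag_mult_left[OF B])
  also have "\<dots> = mat ?n ?n (\<lambda>(j, k). inverse (d j) * ?B $$ (j, k) * d k)"
    by (subst mat_diag_mult_right[of _ ?n]) (auto intro!: eq_matI)
  also have "\<dots> = ?A"
  proof (rule eq_matI)
    fix j k assume "j < dim_row ?A" "k < dim_col ?A"
    then have "j < ?n" "k < ?n" using A by auto
    then show "mat ?n ?n (\<lambda>(j, k). inverse (d j) * ?B $$ (j, k) * d k) $$ (j, k) = ?A $$ (j, k)"
      using eq[of j k] d0[of j] by (simp add: herm_adj_entry field_simps)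
  qed (use A in auto)
  finally have "similar_mat_wit ?A ?B ?D' ?D"
    using A B inv by (intro similar_mat_witI) auto
  moreover have "diagonal_mat ?D" "\<forall>j < ?n. ?D $$ (j, j) \<in> {1, - 1, \<i>, - \<i>}"
    using d by (auto simp: diagonal_mat_def mat_diag_def)
  ultimately show ?thesis
    unfolding same_verts_switching_def using X Y vs by blast
qed

section \<open>Invariance of the weight under switching and isomorphism\<close>

text \<open>Around a closed walk every factor \<open>d\<close> occurs once at the tail of a step and
  once at the head of the preceding one. Cyclic shift is a permutation of the positions, so the two
  products of these factors agree, and being nonzero they cancel.\<close>

lemma same_verts_switching_cycle_weight:
  assumes sw: "same_verts_switching X Y" and vs: "set vs \<subseteq> verts X"
  shows "cycle_weight X vs = cycle_weight Y vs"
proof (cases "vs = []")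
  case False
  let ?n = "length vs" and ?s = "\<lambda>j. Suc j mod length vs"
  obtain d where d0: "\<And>x. x \<in> verts X \<Longrightarrow> d x \<noteq> 0"
    and d: "\<And>x y. x \<in> verts X \<Longrightarrow> y \<in> verts X \<Longrightarrow> d x * entry X x y = entry Y x y * d y"
    using same_verts_switching_entries[OF sw] by blast
  have s: "?s j < ?n" for j
    using False by simp
  have mem: "vs ! j \<in> verts X" if "j < ?n" for j
    using vs that by (meson nth_mem subsetD)
  have "(\<Prod>j<?n. d (vs ! j)) * cycle_weight X vs
      = (\<Prod>j<?n. d (vs ! j) * entry X (vs ! j) (vs ! ?s j))"
    by (simp add: cycle_weight_def prod.distrib)
  also have "\<dots> = (\<Prod>j<?n. entry Y (vs ! j) (vs ! ?s j) * d (vs ! ?s j))"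
    using d mem s by (intro prod.cong) auto
  also have "\<dots> = cycle_weight Y vs * (\<Prod>j<?n. d (vs ! ?s j))"
    by (simp add: cycle_weight_def prod.distrib)
  also have "(\<Prod>j<?n. d (vs ! ?s j)) = (\<Prod>j<?n. d (vs ! j))"
    using prod.reindex_bij_betw[OF bij_betw_Suc_mod, of ?n "\<lambda>j. d (vs ! j)"] False by simp
  finally show ?thesis
    using d0 mem by simp
qed (simp add: cycle_weight_def)

text \<open>Injectivity holds only on the vertex set, so membership is reflected through the image
  of an edge set by first placing all edges inside that vertex set.\<close>

lemma entry_iso:
  assumes X: "mixed_graph X" and inj: "inj_on f (verts X)"
    and ue: "uedges Y = (\<lambda>e. f ` e) ` uedges X" and de: "dedges Y = map_prod f f ` dedges X"
    and xy: "x \<in> verts X" "y \<in> verts X"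
  shows "entry Y (f x) (f y) = entry X x y"
proof -
  have "e \<subseteq> verts X" if "e \<in> uedges X" for e
    using X that unfolding mixed_graph_def by fastforce
  then have "f ` {x, y} \<in> (\<lambda>e. f ` e) ` uedges X \<longleftrightarrow> {x, y} \<in> uedges X"
    using xy by (intro inj_on_image_mem_iff[OF inj_on_image_Pow[OF inj]]) auto
  then have 1: "{f x, f y} \<in> uedges Y \<longleftrightarrow> {x, y} \<in> uedges X"
    by (simp add: ue)
  have dsub: "dedges X \<subseteq> verts X \<times> verts X"
    using X unfolding mixed_graph_def by fastforce
  have 2: "(f a, f b) \<in> dedges Y \<longleftrightarrow> (a, b) \<in> dedges X" if "a \<in> verts X" "b \<in> verts X" for a b
    using inj_on_image_mem_iff[OF map_prod_inj_on[OF inj inj], of "(a, b)" "dedges X"] that dsub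
    by (simp add: de)
  show ?thesis
    unfolding entry_def using 1 2 xy by simp
qed

lemma switching_equivalent_cycle_weight:
  assumes "switching_equivalent X Z"
  obtains f where "bij_betw f (verts X) (verts Z)"
    and "\<And>vs. set vs \<subseteq> verts X \<Longrightarrow> cycle_weight X vs = cycle_weight Z (map f vs)"
proof -
  obtain Y where iso: "mixed_iso Y Z" and sw: "same_verts_switching X Y"
    using assms unfolding switching_equivalent_def by blast
  obtain f where Y: "mixed_graph Y" and f: "bij_betw f (verts Y) (verts Z)"
    "uedges Z = (\<lambda>e. f ` e) ` uedges Y" "dedges Z = map_prod f f ` dedges Y"
    using iso unfolding mixed_iso_def by blast
  have V: "verts X = verts Y"
    using sw unfolding same_verts_switching_def by blast
  show ?thesis
  proof
    show "bij_betw f (verts X) (verts Z)"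
      using f V by simp
    fix vs assume vs: "set vs \<subseteq> verts X"
    have "entry Z (map f vs ! j) (map f vs ! (Suc j mod length vs))
        = entry Y (vs ! j) (vs ! (Suc j mod length vs))" if "j < length vs" for j
    proof -
      have "Suc j mod length vs < length vs" using that by (intro mod_less_divisor) linarith
      moreover from this have "vs ! j \<in> verts Y" "vs ! (Suc j mod length vs) \<in> verts Y"
        using vs V that nth_mem by blast+
      then have "entry Z (f (vs ! j)) (f (vs ! (Suc j mod length vs)))
          = entry Y (vs ! j) (vs ! (Suc j mod length vs))"
        by (rule entry_iso[OF Y bij_betw_imp_inj_on[OF f(1)] f(2,3)])
      ultimately show ?thesis
        using that by simp
    qed
    then have "cycle_weight Z (map f vs) = cycle_weight Y vs"
      unfolding cycle_weight_def length_map by (intro prod.cong) auto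
    then show "cycle_weight X vs = cycle_weight Z (map f vs)"
      using same_verts_switching_cycle_weight[OF sw vs] by simp
  qed
qed

text \<open>Transport of structure along \<open>f\<close>, used to place a copy of \<open>Z\<close>
  on the vertices of \<open>X\<close>. The isomorphism back to \<open>Z\<close> is the inverse of
  \<open>f\<close>.\<close>

lemma mixed_graph_image:
  assumes Z: "mixed_graph Z" and inj: "inj_on f (verts Z)"
    and Y: "Y = \<lparr>verts = f ` verts Z, uedges = (\<lambda>e. f ` e) ` uedges Z,
      dedges = map_prod f f ` dedges Z\<rparr>"
  shows "mixed_graph Y" and "mixed_iso Y Z"
proof -
  have dV: "x \<in> verts Z" "y \<in> verts Z" if "(x, y) \<in> dedges Z" for x y
    using Z that unfolding mixed_graph_def by fastforce+
  have uV: "e \<subseteq> verts Z" if "e \<in> uedges Z" for e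
    using Z that unfolding mixed_graph_def by fastforce
  have ent: "entry Y (f x) (f y) = entry Z x y" if "x \<in> verts Z" "y \<in> verts Z" for x y
    by (rule entry_iso[OF Z inj]) (use that Y in auto)
  show *: "mixed_graph Y"
    unfolding mixed_graph_def
  proof (intro conjI ballI)
    show "finite (verts Y)"
      using Z by (simp add: Y mixed_graph_def)
  next
    fix e assume "e \<in> uedges Y"
    then obtain x y where "x \<in> verts Z" "y \<in> verts Z" "x \<noteq> y" "e = f ` {x, y}"
      using Z unfolding Y mixed_graph_def by fastforce
    then show "\<exists>x \<in> verts Y. \<exists>y \<in> verts Y. x \<noteq> y \<and> e = {x, y}"
      using inj unfolding Y by (intro bexI[of _ "f x"] bexI[of _ "f y"]) (auto dest: inj_onD)
  next
    fix p assume "p \<in> dedges Y"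
    then obtain x y where p: "p = (f x, f y)" "(x, y) \<in> dedges Z"
      by (auto simp: Y)
    then have xy: "x \<in> verts Z" "y \<in> verts Z" "x \<noteq> y" "(y, x) \<notin> dedges Z" "{x, y} \<notin> uedges Z"
      using Z unfolding mixed_graph_def by auto
    have "f x \<noteq> f y"
      using inj xy by (auto dest: inj_onD)
    moreover have "(f y, f x) \<notin> dedges Y"
      using inj_onD[OF inj] dV xy by (auto simp: Y) blast
    \<comment> \<open>An undirected edge would give the entry 1, whereas the entry transported from
      \<open>Z\<close> is \<open>\<i>\<close>.\<close>
    moreover have "entry Y (f x) (f y) \<noteq> 1"
      using ent[of x y] xy p by (simp add: entry_def)
    then have "{f x, f y} \<notin> uedges Y"
      by (auto simp: entry_def)
    ultimately show "case p of (x, y) \<Rightarrow> x \<in> verts Y \<and> y \<in> verts Y \<and> x \<noteq> y \<and>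
        (y, x) \<notin> dedges Y \<and> {x, y} \<notin> uedges Y"
      using xy by (simp add: p Y)
  qed
  let ?g = "inv_into (verts Z) f"
  have g: "?g (f x) = x" if "x \<in> verts Z" for x
    using inj that by simp
  have "bij_betw ?g (verts Y) (verts Z)"
    using bij_betw_inv_into[OF inj_on_imp_bij_betw[OF inj]] by (simp add: Y)
  moreover have "?g ` f ` e = e" if "e \<in> uedges Z" for e
    using inv_into_image_cancel[OF inj] uV[OF that] .
  then have "uedges Z = (\<lambda>e. ?g ` e) ` uedges Y"
    by (simp add: Y image_image)
  moreover have "map_prod ?g ?g (map_prod f f p) = p" if "p \<in> dedges Z" for p
    using that g dV by (cases p) auto
  then have "dedges Z = map_prod ?g ?g ` dedges Y"
    by (simp add: Y image_image)
  ultimately show "mixed_iso Y Z"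
    unfolding mixed_iso_def using * Z by blast
qed

section \<open>Equal weights imply switching equivalence\<close>

lemma cyclic_listing_entry:
  assumes "cyclic_listing X vs" "j < length vs"
  shows "entry X (vs ! j) (vs ! (Suc j mod length vs)) \<in> {1, \<i>, - \<i>}"
proof -
  have "entry X (vs ! j) (vs ! (Suc j mod length vs)) \<noteq> 0"
    using assms unfolding entry_eq_0_iff cyclic_listing_def by auto
  then show ?thesis
    using entry_cases[of X "vs ! j" "vs ! (Suc j mod length vs)"] by simp
qed

lemma prod_unit:
  assumes "\<And>j. j \<in> A \<Longrightarrow> f j \<in> {1, - 1, \<i>, - \<i>}"
  shows "prod f A \<in> {1, - 1, \<i>, - \<i>}"
  using assms
proof (induction A rule: infinite_finite_induct)
  case (insert x F)
  then have "f x \<in> {1, - 1, \<i>, - \<i>}" "prod f F \<in> {1, - 1, \<i>, - \<i>}" by auto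
  then show ?case using insert.hyps by auto
qed auto

text \<open>In a distinct list an edge determines the two positions of its ends, so the cycle has no
  chords.\<close>

lemma cyclic_listing_adjacent:
  assumes "cyclic_listing X vs" "j < length vs" "k < length vs"
    "{vs ! j, vs ! k} \<in> underlying_edges X"
  shows "k = Suc j mod length vs \<or> j = Suc k mod length vs"
proof -
  have vs: "distinct vs" and
    "{vs ! j, vs ! k} \<in> {{vs ! l, vs ! (Suc l mod length vs)} | l. l < length vs}"
    using assms unfolding cyclic_listing_def by auto
  then obtain l where l: "l < length vs" "{vs ! j, vs ! k} = {vs ! l, vs ! (Suc l mod length vs)}"
    by blast
  moreover have "Suc l mod length vs < length vs"
    using l(1) by (intro mod_less_divisor) linarith
  ultimately show ?thesis
    using assms(2,3) vs by (auto simp: doubleton_eq_iff nth_eq_iff_index_eq)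
qed

text \<open>\<open>Z\<close> is copied onto the vertices of \<open>X\<close> by matching the two
  listings position by position. Along the cycle the switching relation is a first-order recursion
  for the diagonal, solvable from the value 1 at position 0; equality of the weights is exactly the
  condition for the solution to close up.\<close>

lemma switching_equivalent_cyclic:
  assumes X: "cyclic_listing X vs" and Z: "cyclic_listing Z us"
    and len: "length us = length vs" and w: "cycle_weight X vs = cycle_weight Z us"
  shows "switching_equivalent X Z"
proof -
  let ?n = "length vs" and ?s = "\<lambda>j. Suc j mod length vs"
  have mX: "mixed_graph X" and mZ: "mixed_graph Z"
    and vs: "distinct vs" "verts X = set vs" and us: "distinct us" "verts Z = set us"
    and n: "?n \<ge> 3"
    using X Z by (auto simp: cyclic_listing_def)
  have s: "?s j < ?n" for j
    using n by (intro mod_less_divisor) linarith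
  define f where "f = (!) vs \<circ> inv_into {..<?n} ((!) us)"
  have bu: "bij_betw ((!) us) {..<?n} (verts Z)"
    using us len by (intro bij_betw_nth) auto
  have bv: "bij_betw ((!) vs) {..<?n} (verts X)"
    using vs by (intro bij_betw_nth) auto
  have f: "bij_betw f (verts Z) (verts X)"
    unfolding f_def by (rule bij_betw_trans[OF bij_betw_inv_into[OF bu] bv])
  have fu: "f (us ! j) = vs ! j" if "j < ?n" for j
    using that bij_betw_inv_into_left[OF bu] by (simp add: f_def)
  define Y where "Y = \<lparr>verts = f ` verts Z, uedges = (\<lambda>e. f ` e) ` uedges Z,
      dedges = map_prod f f ` dedges Z\<rparr>"
  have inj: "inj_on f (verts Z)"
    using f by (rule bij_betw_imp_inj_on)
  note Y = mixed_graph_image[OF mZ inj Y_def]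
  have VY: "verts Y = verts X"
    using f by (simp add: Y_def bij_betw_def)
  have ent: "entry Y (vs ! j) (vs ! k) = entry Z (us ! j) (us ! k)" if "j < ?n" "k < ?n" for j k
  proof -
    have "entry Y (f (us ! j)) (f (us ! k)) = entry Z (us ! j) (us ! k)"
      by (rule entry_iso[OF mZ inj]) (use that us len in \<open>auto simp: Y_def\<close>)
    then show ?thesis using fu that by simp
  qed
  let ?a = "\<lambda>j. entry X (vs ! j) (vs ! ?s j)" and ?b = "\<lambda>j. entry Z (us ! j) (us ! ?s j)"
  have a: "?a j \<in> {1, \<i>, - \<i>}" and b: "?b j \<in> {1, \<i>, - \<i>}" if "j < ?n" for j
    using cyclic_listing_entry[OF X that] cyclic_listing_entry[OF Z, of j] that len by simp_all
  have b0: "?b j \<noteq> 0" if "j < ?n" for j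
    using b[OF that] by auto
  \<comment> \<open>The solution of the recursion \<open>d (Suc j) = d j * ?a j / ?b j\<close> with
    \<open>d 0 = 1\<close>.\<close>
  define d where "d j = (\<Prod>i<j. ?a i / ?b i)" for j
  have d: "d j \<in> {1, - 1, \<i>, - \<i>}" if "j < ?n" for j
    unfolding d_def
  proof (rule prod_unit)
    fix i assume "i \<in> {..<j}"
    then have "i < ?n" using that by simp
    then show "?a i / ?b i \<in> {1, - 1, \<i>, - \<i>}" using a[of i] b[of i] by auto
  qed
  have dn: "d ?n = 1"
  proof -
    have "d ?n = cycle_weight X vs / cycle_weight Z us"
      by (simp add: d_def cycle_weight_def prod_dividef len)
    moreover have "cycle_weight Z us \<noteq> 0"
      using b0 by (simp add: cycle_weight_def len)
    ultimately show ?thesis using w by simp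
  qed
  have step: "d j * ?a j = ?b j * d (?s j)" if "j < ?n" for j
  proof -
    have "d (Suc j) * ?b j = d j * ?a j"
      using b0[OF that] by (simp add: d_def)
    \<comment> \<open>Only at the last position do \<open>?s j\<close> and \<open>Suc j\<close>
      differ; there \<open>d 0\<close> and \<open>d ?n\<close> are both 1.\<close>
    moreover have "d (?s j) = d (Suc j)"
    proof (cases "Suc j = ?n")
      case True
      then show ?thesis using dn by (simp add: d_def)
    qed (use that in simp)
    ultimately show ?thesis by (simp add: mult.commute)
  qed
  have eq: "d j * entry X (vs ! j) (vs ! k) = entry Y (vs ! j) (vs ! k) * d k"
    if jk: "j < ?n" "k < ?n" for j k
  proof -
    consider "k = ?s j" | "j = ?s k"
      | "{vs ! j, vs ! k} \<notin> underlying_edges X" "{us ! j, us ! k} \<notin> underlying_edges Z"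
      using cyclic_listing_adjacent[OF X jk] cyclic_listing_adjacent[OF Z, of j k] jk len by auto
    then show ?thesis
    proof cases
      case 1
      then show ?thesis using step[OF jk(1)] ent[OF jk] by simp
    next
      \<comment> \<open>Here the edge is traversed backwards. Conjugating the forward relation
        reverses both entries by Hermitian symmetry, and multiplying by \<open>d k * d j\<close>
        removes the conjugates because the values of \<open>d\<close> have modulus 1.\<close>
      case 2
      have unit: "d i * cnj (d i) = 1" if "i < ?n" for i
        using d[OF that] by auto
      have "cnj (d k * ?a k) = cnj (?b k * d j)"
        using step[OF jk(2)] 2 by simp
      then have "cnj (d k) * entry X (vs ! j) (vs ! k) = entry Z (us ! j) (us ! k) * cnj (d j)"
        using 2 entry_cnj[OF mX, of "vs ! j"] entry_cnj[OF mZ, of "us ! j"] by simp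
      then have "(d k * cnj (d k)) * d j * entry X (vs ! j) (vs ! k)
          = entry Z (us ! j) (us ! k) * d k * (d j * cnj (d j))"
        by (simp add: algebra_simps)
      then show ?thesis
        using unit jk ent[OF jk] by simp
    next
      case 3
      then show ?thesis using ent[OF jk] by (simp flip: entry_eq_0_iff)
    qed
  qed
  have "same_verts_switching X Y"
    by (rule same_verts_switchingI[where vs = vs and d = d]) (use mX Y VY vs d eq in auto)
  then show ?thesis
    unfolding switching_equivalent_def using Y by blast
qed

section \<open>Reversing the direction of traversal\<close>

text \<open>The reversed list uses the same edges backwards, which conjugates every factor. In the
  classification this trades the weight \<open>- \<i>\<close> for \<open>\<i>\<close>.\<close>

lemma cyclic_listing_rev:
  assumes X: "cyclic_listing X vs"
  shows "cyclic_listing X (rev vs)" and "cycle_weight X (rev vs) = cnj (cycle_weight X vs)"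
proof -
  let ?n = "length vs" and ?s = "\<lambda>j. Suc j mod length vs"
  \<comment> \<open>Step \<open>j\<close> of the reversed list goes from position
    \<open>?n - 1 - j\<close> of \<open>vs\<close> to \<open>?n - 2 - j\<close>, so it is step
    \<open>?n - 2 - j\<close> of \<open>vs\<close> run backwards; the closing step corresponds to
    itself.\<close>
  define p where "p j = (if Suc j = ?n then j else ?n - 2 - j)" for j
  have n: "?n \<ge> 3" and mX: "mixed_graph X"
    using X by (auto simp: cyclic_listing_def)
  have p: "p j < ?n" "p (p j) = j" if "j < ?n" for j
    using that n by (auto simp: p_def)
  have bij: "bij_betw p {..<?n} {..<?n}"
    using p by (intro bij_betwI[where g = p]) auto
  have r: "rev vs ! j = vs ! ?s (p j)" "rev vs ! ?s j = vs ! p j" if "j < ?n" for j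
  proof -
    have "rev vs ! j = vs ! ?s (p j) \<and> rev vs ! ?s j = vs ! p j"
    proof (cases "Suc j = ?n")
      case True
      have "rev vs ! j = vs ! 0"
        using rev_nth[OF that] by (simp only: True diff_self_eq_0)
      moreover have "rev vs ! 0 = vs ! j"
        using rev_nth[of 0 vs] that by (simp only: True[symmetric] diff_Suc_Suc diff_zero zero_less_Suc)
      moreover have "p j = j" "?s j = 0"
        by (simp_all add: p_def True)
      ultimately show ?thesis by simp
    next
      case False
      then have "Suc j < ?n" using that by simp
      then have "Suc (?n - 2 - j) = ?n - Suc j" by simp
      then show ?thesis using \<open>Suc j < ?n\<close> by (simp add: p_def rev_nth)
    qed
    then show "rev vs ! j = vs ! ?s (p j)" "rev vs ! ?s j = vs ! p j" by auto
  qed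
  have "{{rev vs ! j, rev vs ! ?s j} | j. j < ?n} = (\<lambda>j. {rev vs ! j, rev vs ! ?s j}) ` {..<?n}"
    by auto
  also have "\<dots> = (\<lambda>j. {vs ! ?s (p j), vs ! p j}) ` {..<?n}"
  proof (intro image_cong refl)
    fix j assume "j \<in> {..<?n}"
    then have "j < ?n" by simp
    show "{rev vs ! j, rev vs ! ?s j} = {vs ! ?s (p j), vs ! p j}"
      by (simp only: r[OF \<open>j < ?n\<close>])
  qed
  also have "\<dots> = (\<lambda>j. {vs ! ?s j, vs ! j}) ` p ` {..<?n}"
    by (simp add: image_image)
  also have "\<dots> = {{vs ! j, vs ! ?s j} | j. j < ?n}"
    using bij by (auto simp: bij_betw_def insert_commute)
  finally show "cyclic_listing X (rev vs)"
    using X by (simp add: cyclic_listing_def)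
  have "cycle_weight X (rev vs) = (\<Prod>j<?n. entry X (vs ! ?s (p j)) (vs ! p j))"
    unfolding cycle_weight_def using r by simp
  also have "\<dots> = (\<Prod>j<?n. entry X (vs ! ?s j) (vs ! j))"
    by (rule prod.reindex_bij_betw[OF bij])
  also have "\<dots> = cnj (cycle_weight X vs)"
    unfolding cycle_weight_def cnj_prod by (intro prod.cong refl entry_cnj[OF mX])
  finally show "cycle_weight X (rev vs) = cnj (cycle_weight X vs)" .
qed

section \<open>Weights of the three representatives\<close>

text \<open>The natural order runs along every directed edge in its own direction, so each
  contributes \<open>\<i>\<close> and every other edge contributes 1.\<close>

lemma cycle_with_dedges_weight:
  assumes n: "n \<ge> 3" and A: "A \<subseteq> {(j, Suc j mod n) | j. j < n}"
  shows "cyclic_listing (cycle_with_dedges n A) [0..<n]"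
    and "cycle_weight (cycle_with_dedges n A) [0..<n] = \<i> ^ card {j. j < n \<and> (j, Suc j mod n) \<in> A}"
proof -
  let ?C = "cycle_with_dedges n A"
  have m: "mixed_graph ?C"
    using mixed_cycle_cycle_with_dedges[OF n A] by (simp add: mixed_cycle_def)
  have "underlying_edges ?C = {{j, Suc j mod n} | j. j < n}"
    using A unfolding underlying_edges_def cycle_with_dedges_def by simp blast
  also have "\<dots> = {{[0..<n] ! j, [0..<n] ! (Suc j mod n)} | j. j < n}"
    using n by (intro Collect_cong ex_cong1) auto
  finally show "cyclic_listing ?C [0..<n]"
    using m n by (simp add: cyclic_listing_def atLeast0LessThan) (simp add: cycle_with_dedges_def)
  have "entry ?C j (Suc j mod n) = (if (j, Suc j mod n) \<in> A then \<i> else 1)" if "j < n" for j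
  proof (cases "(j, Suc j mod n) \<in> A")
    case True
    then have "(j, Suc j mod n) \<in> dedges ?C" by (simp add: cycle_with_dedges_def)
    moreover from this have "{j, Suc j mod n} \<notin> uedges ?C"
      using m unfolding mixed_graph_def by auto
    ultimately show ?thesis using True by (simp add: entry_def)
  next
    case False
    then have "{j, Suc j mod n} \<in> uedges ?C" using that by (auto simp: cycle_with_dedges_def)
    then show ?thesis using False by (simp add: entry_def)
  qed
  then have "cycle_weight ?C [0..<n] = (\<Prod>j<n. if (j, Suc j mod n) \<in> A then \<i> else 1)"
    unfolding cycle_weight_def using n by (intro prod.cong) auto
  also have "\<dots> = \<i> ^ card {j. j < n \<and> (j, Suc j mod n) \<in> A}"
    by (simp add: prod.inter_filter[symmetric] del: prod.inter_filter)
  finally show "cycle_weight ?C [0..<n] = \<i> ^ card {j. j < n \<and> (j, Suc j mod n) \<in> A}" .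
qed

lemma C0_C1_C2_listing:
  assumes n: "n \<ge> 3"
  shows "cyclic_listing (C0 n) [0..<n]" "cyclic_listing (C1 n) [0..<n]"
    "cyclic_listing (C2 n) [0..<n]" "cycle_weight (C0 n) [0..<n] = 1"
    "cycle_weight (C1 n) [0..<n] = \<i>" "cycle_weight (C2 n) [0..<n] = - 1"
proof -
  have A1: "{(0, 1)} \<subseteq> {(j, Suc j mod n) | j. j < n}"
    and A2: "{(0, 1), (1, 2)} \<subseteq> {(j, Suc j mod n) | j. j < n}"
    using n by (force simp: mod_Suc numeral_2_eq_2)+
  have c1: "{j. j < n \<and> (j, Suc j mod n) \<in> {(0, 1)}} = {0}"
    and c2: "{j. j < n \<and> (j, Suc j mod n) \<in> {(0, 1), (1, 2)}} = {0, 1}"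
    using n by auto
  show "cyclic_listing (C0 n) [0..<n]" "cyclic_listing (C1 n) [0..<n]"
    "cyclic_listing (C2 n) [0..<n]"
    unfolding C0_def C1_def C2_def
    by (rule cycle_with_dedges_weight[OF n]; use A1 A2 in blast)+
  show "cycle_weight (C0 n) [0..<n] = 1"
    unfolding C0_def by (subst cycle_with_dedges_weight[OF n]) auto
  show "cycle_weight (C1 n) [0..<n] = \<i>"
    unfolding C1_def cycle_with_dedges_weight(2)[OF n A1] c1 by simp
  show "cycle_weight (C2 n) [0..<n] = - 1"
    unfolding C2_def cycle_with_dedges_weight(2)[OF n A2] c2 by simp
qed

section \<open>Possible weights of other lists in \<open>C0\<close> and \<open>C1\<close>\<close>

lemma prod_0_1:
  fixes f :: "'b \<Rightarrow> 'c :: comm_semiring_1"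
  assumes "\<And>j. j \<in> A \<Longrightarrow> f j \<in> {0, 1}"
  shows "prod f A \<in> {0, 1}"
  using assms by (induction A rule: infinite_finite_induct) fastforce+

lemma cycle_weight_C0: "cycle_weight (C0 n) us \<in> {0, 1}"
  unfolding cycle_weight_def
  by (rule prod_0_1) (simp add: entry_def C0_def cycle_with_dedges_def)

text \<open>At most one factor of the weight of a distinct list uses the directed edge of \<open>C\<^sub>n\<^sup>1\<close>.\<close>

lemma cycle_weight_C1:
  assumes us: "distinct us" "length us \<ge> 3"
  shows "cycle_weight (C1 n) us \<in> {0, 1, \<i>, - \<i>}"
proof -
  let ?m = "length us" and ?s = "\<lambda>j. Suc j mod length us"
  let ?e = "\<lambda>j. entry (C1 n) (us ! j) (us ! ?s j)"
  have e: "?e j \<in> {0, 1}" if "{us ! j, us ! ?s j} \<noteq> {0, 1}" for j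
    using that by (auto simp: entry_def C1_def cycle_with_dedges_def)
  show ?thesis
  proof (cases "\<exists>j<?m. {us ! j, us ! ?s j} = {0, 1}")
    case False
    then show ?thesis
      unfolding cycle_weight_def using prod_0_1[of "{..<?m}" ?e] e by blast
  next
    case True
    then obtain j where j: "j < ?m" "{us ! j, us ! ?s j} = {0, 1}" by blast
    have s: "?s i < ?m" for i
      using us by (intro mod_less_divisor) linarith
    \<comment> \<open>By distinctness a second occurrence of the pair would have to run backwards,
      so two cyclic steps would return to the start; length at least 3 excludes this.\<close>
    have "{us ! i, us ! ?s i} \<noteq> {0, 1}" if i: "i < ?m" "i \<noteq> j" for i
    proof
      assume "{us ! i, us ! ?s i} = {0, 1}"
      then have "{us ! i, us ! ?s i} = {us ! j, us ! ?s j}" using j by simp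
      then have "i = ?s j" "?s i = j"
        using us(1) i j(1) s by (auto simp: doubleton_eq_iff nth_eq_iff_index_eq)
      then show False
        using us(2) i j(1) by (auto simp: mod_Suc split: if_splits)
    qed
    then have "prod ?e ({..<?m} - {j}) \<in> {0, 1}"
      using e by (intro prod_0_1) auto
    moreover have "cycle_weight (C1 n) us = ?e j * prod ?e ({..<?m} - {j})"
      unfolding cycle_weight_def using j(1) by (intro prod.remove) auto
    ultimately show ?thesis
      using entry_cases[of "C1 n" "us ! j" "us ! ?s j"] by auto
  qed
qed

section \<open>Uniqueness of the representative and the classification\<close>

text \<open>The list is pulled back to \<open>X\<close> along the first equivalence and pushed
  forward along the second; each passage preserves the weight.\<close>

lemma switching_equivalent_common_weight:
  assumes Z: "switching_equivalent X Z" and Z': "switching_equivalent X Z'"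
    and us: "distinct us" "set us = verts Z"
  obtains us' where "distinct us'" "length us' = length us" "cycle_weight Z us = cycle_weight Z' us'"
proof -
  obtain f where f: "bij_betw f (verts X) (verts Z)"
    and wf: "\<And>vs. set vs \<subseteq> verts X \<Longrightarrow> cycle_weight X vs = cycle_weight Z (map f vs)"
    using switching_equivalent_cycle_weight[OF Z] by blast
  obtain g where g: "bij_betw g (verts X) (verts Z')"
    and wg: "\<And>vs. set vs \<subseteq> verts X \<Longrightarrow> cycle_weight X vs = cycle_weight Z' (map g vs)"
    using switching_equivalent_cycle_weight[OF Z'] by blast
  define vs where "vs = map (inv_into (verts X) f) us"
  have inv: "bij_betw (inv_into (verts X) f) (set us) (verts X)"
    using bij_betw_inv_into[OF f] us by simp
  then have vs: "distinct vs" "set vs = verts X"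
    using us by (auto simp: vs_def distinct_map bij_betw_def)
  have "map f vs = us"
    unfolding vs_def map_map o_def
    by (rule map_idI) (use us bij_betw_inv_into_right[OF f] in blast)
  then have "cycle_weight Z us = cycle_weight Z' (map g vs)"
    using wf[of vs] wg[of vs] vs by simp
  moreover have "distinct (map g vs)"
    using vs g by (simp add: distinct_map bij_betw_def)
  ultimately show ?thesis
    using that[of "map g vs"] by (simp add: vs_def)
qed

theorem theorem2p1:
  fixes X :: "'a mixed_graph" and n :: nat
  assumes "mixed_cycle X" and "card (verts X) = n" and "n \<ge> 3"
  shows "\<exists>!C. C \<in> {C0 n, C1 n, C2 n} \<and> switching_equivalent X C"
proof -
  note n = \<open>n \<ge> 3\<close>
  note C = C0_C1_C2_listing[OF n]
  obtain vs where vs: "cyclic_listing X vs"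
    using assms(1) unfolding mixed_cycle_def is_cycle_def cyclic_listing_def by blast
  then have len: "length vs = n"
    using assms(2) by (auto simp: cyclic_listing_def distinct_card)
  have sw: "switching_equivalent X Z"
    if "cyclic_listing X us" "length us = n" "cyclic_listing Z [0..<n]"
      "cycle_weight X us = cycle_weight Z [0..<n]" for us and Z :: "nat mixed_graph"
    using switching_equivalent_cyclic[OF that(1,3)] that(2,4) by simp
  have "cycle_weight X vs \<in> {1, - 1, \<i>, - \<i>}"
    unfolding cycle_weight_def using cyclic_listing_entry[OF vs] by (intro prod_unit) auto
  \<comment> \<open>The remaining weight \<open>- \<i>\<close> appears as weight \<open>\<i>\<close>
    of the reversed listing.\<close>
  then consider "cycle_weight X vs = 1" | "cycle_weight X vs = - 1"
    | "cycle_weight X vs = \<i>" | "cycle_weight X (rev vs) = \<i>"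
    using cyclic_listing_rev(2)[OF vs] by auto
  then have ex: "\<exists>Z. Z \<in> {C0 n, C1 n, C2 n} \<and> switching_equivalent X Z"
  proof cases
    case 1
    then show ?thesis using sw[OF vs len C(1)] C(4) by auto
  next
    case 2
    then show ?thesis using sw[OF vs len C(3)] C(6) by auto
  next
    case 3
    then show ?thesis using sw[OF vs len C(2)] C(5) by auto
  next
    case 4
    then show ?thesis using sw[OF cyclic_listing_rev(1)[OF vs] _ C(2)] C(5) len by auto
  qed
  have common: "\<exists>us. distinct us \<and> length us = n \<and> cycle_weight Z [0..<n] = cycle_weight Z' us"
    if "switching_equivalent X Z" "switching_equivalent X Z'" "cyclic_listing Z [0..<n]"
    for Z Z' :: "nat mixed_graph"
  proof (rule switching_equivalent_common_weight[OF that(1,2)])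
    show "distinct [0..<n]" "set [0..<n] = verts Z"
      using that(3) by (simp_all add: cyclic_listing_def)
  qed auto
  \<comment> \<open>Each exclusion transports the natural listing of the cycle with more directed
    edges into the one with fewer, where its weight is unattainable: \<open>\<i>\<close> and -1 in
    \<open>C0\<close>, and -1 in \<open>C1\<close>.\<close>
  have "\<not> (switching_equivalent X (C1 n) \<and> switching_equivalent X (C0 n))"
  proof
    assume "switching_equivalent X (C1 n) \<and> switching_equivalent X (C0 n)"
    then obtain us where "distinct us" "length us = n" "cycle_weight (C0 n) us = \<i>"
      using common[OF _ _ C(2), of "C0 n"] C(5) by auto
    then show False
      using cycle_weight_C0[of n us] by (auto simp: complex_eq_iff)
  qed
  moreover have "\<not> (switching_equivalent X (C2 n) \<and> switching_equivalent X (C0 n))"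
  proof
    assume "switching_equivalent X (C2 n) \<and> switching_equivalent X (C0 n)"
    then obtain us where "distinct us" "length us = n" "cycle_weight (C0 n) us = - 1"
      using common[OF _ _ C(3), of "C0 n"] C(6) by auto
    then show False
      using cycle_weight_C0[of n us] by (auto simp: complex_eq_iff)
  qed
  moreover have "\<not> (switching_equivalent X (C2 n) \<and> switching_equivalent X (C1 n))"
  proof
    assume "switching_equivalent X (C2 n) \<and> switching_equivalent X (C1 n)"
    then obtain us where "distinct us" "length us = n" "cycle_weight (C1 n) us = - 1"
      using common[OF _ _ C(3), of "C1 n"] C(6) by auto
    then show False
      using cycle_weight_C1[of us n] n by (auto simp: complex_eq_iff)
  qed
  ultimately show ?thesis
    using ex by blast
qed

end
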